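(* Let $M_n$ be the algebra of all $n\times n$ complex matrices and let $A,X\in M_n$. Then $X$ is the core inverse of $A$ if and only if $AXA=A$, $XM_n=AM_n$ and $M_nX=M_nA^*$.
   Context: Here $A^*$ is the conjugate transpose, $AM_n=\{AZ:Z\in M_n\}$, $M_nA=\{ZA:Z\in M_n\}$, and $\mathcal R(A)$ is the range (column space) of $A$. A matrix $X\in M_n$ is the core inverse of $A\in M_n$ if $AX=P_A$ and $\mathcal R(X)\subseteq\mathcal R(A)$, where $P_A$ is the orthogonal projection onto $\mathcal R(A)$ (such $X$ exists iff $\mathrm{rank}(A)=\mathrm{rank}(A^2)$, and is then unique). *)

theory Defs
  imports "Jordan_Normal_Form.Schur_Decomposition"
begin

(* The operator \<bullet>c is the standard Hermitian inner product on complex vectors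
   (conjugate-linear in the second argument); mat_adjoint is the conjugate transpose. *)

abbreviation mat_range :: "nat \<Rightarrow> complex mat \<Rightarrow> complex vec set" where
  "mat_range n A \<equiv> vec_space.col_space n A"

definition is_orthogonal_projection :: "nat \<Rightarrow> complex vec set \<Rightarrow> complex mat \<Rightarrow> bool" where
  "is_orthogonal_projection n S P \<longleftrightarrow>
     P \<in> carrier_mat n n \<and>
     (\<forall>x \<in> carrier_vec n. P *\<^sub>v x \<in> S \<and> (\<forall>y \<in> S. (x - P *\<^sub>v x) \<bullet>c y = 0))"

lemma orthogonal_projection_unique:
  assumes A: "A \<in> carrier_mat n n"
    and P: "is_orthogonal_projection n (mat_range n A) P"
    and Q: "is_orthogonal_projection n (mat_range n A) Q"
  shows "P = Q"
proof (rule eq_matI)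
  interpret vec_space "TYPE(complex)" n .
  have Pc: "P \<in> carrier_mat n n" and Qc: "Q \<in> carrier_mat n n"
    using P Q by (auto simp: is_orthogonal_projection_def)
  then show "dim_row P = dim_row Q" "dim_col P = dim_col Q" by auto
  have eq: "P *\<^sub>v x = Q *\<^sub>v x" if x: "x \<in> carrier_vec n" for x
  proof -
    let ?d = "P *\<^sub>v x - Q *\<^sub>v x"
    have Px: "P *\<^sub>v x \<in> carrier_vec n" and Qx: "Q *\<^sub>v x \<in> carrier_vec n"
      using Pc Qc x by auto
    have "P *\<^sub>v x \<in> mat_range n A" "Q *\<^sub>v x \<in> mat_range n A"
      using P Q x by (auto simp: is_orthogonal_projection_def)
    then obtain u v where u: "u \<in> carrier_vec n" "A *\<^sub>v u = P *\<^sub>v x"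
      and v: "v \<in> carrier_vec n" "A *\<^sub>v v = Q *\<^sub>v x"
      using A col_space_eq[OF A] by auto
    have "A *\<^sub>v (u - v) = ?d"
      using mult_minus_distrib_mat_vec[OF A u(1) v(1)] u v by simp
    then have "?d \<in> mat_range n A"
      using A u v Px Qx unfolding col_space_eq[OF A] by fastforce
    then have "(x - P *\<^sub>v x) \<bullet>c ?d = 0" "(x - Q *\<^sub>v x) \<bullet>c ?d = 0"
      using P Q x by (auto simp: is_orthogonal_projection_def)
    moreover have "?d = (x - Q *\<^sub>v x) - (x - P *\<^sub>v x)"
    proof -
      have "p - q = (x - q) - (x - p)"
        if "p \<in> carrier_vec n" "q \<in> carrier_vec n" for p q :: "complex vec"
        using that x by (intro eq_vecI) auto
      then show ?thesis using Px Qx .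
    qed
    moreover have "((x - Q *\<^sub>v x) - (x - P *\<^sub>v x)) \<bullet>c ?d
        = (x - Q *\<^sub>v x) \<bullet>c ?d - (x - P *\<^sub>v x) \<bullet>c ?d"
      using x Px Qx by (intro minus_scalar_prod_distrib[of _ n]) auto
    ultimately have "?d \<bullet>c ?d = 0" by simp
    then have "?d = 0\<^sub>v n"
      using conjugate_square_eq_0_vec[of ?d n] Px Qx by simp
    then have "(P *\<^sub>v x) $ i = (Q *\<^sub>v x) $ i" if "i < n" for i
      using that Px Qx by (metis carrier_vecD index_minus_vec(1) index_zero_vec(1) right_minus_eq)
    then show ?thesis
      using carrier_vecD[OF Px] carrier_vecD[OF Qx] by (intro eq_vecI) metis+
  qed
  fix i j assume "i < dim_row Q" "j < dim_col Q"
  with Qc have i: "i < n" and j: "j < n" by auto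
  have "row P i \<bullet> unit_vec n j = row Q i \<bullet> unit_vec n j"
    using eq[of "unit_vec n j"] i Pc Qc
    by (metis carrier_matD(1) index_mult_mat_vec unit_vec_carrier)
  then show "P $$ (i, j) = Q $$ (i, j)"
    using i j Pc Qc by (simp add: scalar_prod_right_unit[of _ n])
qed

definition is_core_inverse :: "nat \<Rightarrow> complex mat \<Rightarrow> complex mat \<Rightarrow> bool" where
  "is_core_inverse n A X \<longleftrightarrow>
     X \<in> carrier_mat n n \<and>
     is_orthogonal_projection n (mat_range n A) (A * X) \<and>
     mat_range n X \<subseteq> mat_range n A"

end

theory Submission
  imports Defs
begin

text \<open>
  By the normal equations, \<open>A X\<close> is the orthogonal projection onto the range of \<open>A\<close> iff
  \<open>A\<^sup>* (A X) = A\<^sup>*\<close>, and \<open>\<R>(X) \<subseteq> \<R>(A)\<close> means \<open>X = A Y\<close>. The only point using finite dimension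
  is that \<open>A X A = A\<close> and \<open>X = A Y\<close> force \<open>X A A = A\<close>, which follows from the fact that one-sided
  inverses of square matrices are two-sided; the rest is a calculation with these identities.
\<close>

section \<open>The conjugate transpose\<close>

lemma mat_adjoint_carrier [simp]:
  "A \<in> carrier_mat m n \<Longrightarrow> mat_adjoint A \<in> carrier_mat n m"
  unfolding mat_adjoint_def by auto

lemma dim_mat_adjoint [simp]:
  "dim_row (mat_adjoint A) = dim_col A" "dim_col (mat_adjoint A) = dim_row A"
  unfolding mat_adjoint_def by auto

lemma mat_adjoint_index:
  assumes "i < dim_col A" "j < dim_row A"
  shows "mat_adjoint A $$ (i, j) = conjugate (A $$ (j, i))"
  using assms unfolding mat_adjoint_def by (simp add: mat_of_rows_index)

lemma mat_adjoint_adjoint: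
  "mat_adjoint (mat_adjoint A) = A"
  by (intro eq_matI) (auto simp: mat_adjoint_index)

lemma mat_adjoint_mult:
  assumes "A \<in> carrier_mat m n" "B \<in> carrier_mat n k"
  shows "mat_adjoint (A * B) = mat_adjoint B * mat_adjoint A"
proof -
  have c: "mat_adjoint A \<in> carrier_mat n m" "mat_adjoint B \<in> carrier_mat k n"
          "mat_adjoint (A * B) \<in> carrier_mat k m"
    using assms by auto
  show ?thesis
    by (rule eq_matI)
      (use assms c in \<open>auto simp: mat_adjoint_index scalar_prod_def sum_conjugate
        conjugate_dist_mul mult.commute intro!: sum.cong\<close>)
qed

text \<open>Turns orthogonality to the range of \<open>A\<close> into membership in the kernel of
  \<open>mat_adjoint A\<close>. Both sides expand to one double sum, up to the order of
  summation.\<close>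

lemma cscalar_prod_mult_mat_vec:
  assumes A: "A \<in> carrier_mat m n" and v: "v \<in> carrier_vec m" and w: "w \<in> carrier_vec n"
  shows "v \<bullet>c (A *\<^sub>v w) = (mat_adjoint A *\<^sub>v v) \<bullet>c w"
proof -
  have A': "mat_adjoint A \<in> carrier_mat n m" using A by simp
  have "v \<bullet>c (A *\<^sub>v w) =
      (\<Sum>i<m. \<Sum>j<n. v $ i * (conjugate (A $$ (i, j)) * conjugate (w $ j)))"
    using A v w
    by (simp add: scalar_prod_def sum_conjugate conjugate_dist_mul sum_distrib_left
        atLeast0LessThan)
  also have "\<dots> = (\<Sum>j<n. \<Sum>i<m. v $ i * (conjugate (A $$ (i, j)) * conjugate (w $ j)))"
    by (rule sum.swap)
  also have "\<dots> = (mat_adjoint A *\<^sub>v v) \<bullet>c w"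
    using A A' v w
    by (simp add: scalar_prod_def mat_adjoint_index sum_distrib_left atLeast0LessThan ac_simps)
  finally show ?thesis .
qed

section \<open>Matrices as linear maps and inclusion of column spaces\<close>

lemma eq_mat_mult_vecI:
  fixes A B :: "'a :: semiring_1 mat"
  assumes A: "A \<in> carrier_mat m n" and B: "B \<in> carrier_mat m n"
    and eq: "\<And>x. x \<in> carrier_vec n \<Longrightarrow> A *\<^sub>v x = B *\<^sub>v x"
  shows "A = B"
proof (rule eq_matI)
  fix i j assume "i < dim_row B" "j < dim_col B"
  then have i: "i < m" and j: "j < n" using B by auto
  have "(A *\<^sub>v unit_vec n j) $ i = (B *\<^sub>v unit_vec n j) $ i" by (simp add: eq)
  then show "A $$ (i, j) = B $$ (i, j)"
    using i j A B by (simp add: scalar_prod_right_unit[of _ n])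
qed (use A B in auto)

lemma mat_range_eq:
  assumes "A \<in> carrier_mat n m"
  shows "mat_range n A = {A *\<^sub>v x |x. x \<in> carrier_vec m}"
  using assms unfolding vec_space.col_space_eq[OF assms] by auto

text \<open>Every column of \<open>X\<close> lies in the range of \<open>X\<close>, so under the
  inclusion it is \<open>A\<close> applied to some vector; these vectors are the columns of
  \<open>Y\<close>. Conversely, \<open>X\<close> maps \<open>x\<close> to \<open>A\<close> applied
  to the image of \<open>x\<close> under \<open>Y\<close>.\<close>

lemma mat_range_subset_iff:
  assumes A: "A \<in> carrier_mat n n" and X: "X \<in> carrier_mat n n"
  shows "mat_range n X \<subseteq> mat_range n A \<longleftrightarrow> (\<exists>Y \<in> carrier_mat n n. X = A * Y)"
proof
  assume sub: "mat_range n X \<subseteq> mat_range n A"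
  have "\<exists>y. y \<in> carrier_vec n \<and> col X j = A *\<^sub>v y" if "j < n" for j
  proof -
    have "col X j = X *\<^sub>v unit_vec n j"
      using that X by (intro eq_vecI) (auto simp: scalar_prod_right_unit[of _ n])
    then have "col X j \<in> mat_range n X" using X by (auto simp: mat_range_eq)
    then show ?thesis using sub A by (auto simp: mat_range_eq)
  qed
  then obtain y where y: "\<And>j. j < n \<Longrightarrow> y j \<in> carrier_vec n \<and> col X j = A *\<^sub>v y j"
    by metis
  define Y where "Y = mat_of_cols n (map y [0..<n])"
  have Y: "Y \<in> carrier_mat n n" using mat_of_cols_carrier(1)[of n "map y [0..<n]"] by (simp add: Y_def)
  have colY: "col Y j = y j" if "j < n" for j
    using that y unfolding Y_def by (subst col_mat_of_cols) auto
  have "X = A * Y"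
  proof (rule mat_col_eqI)
    fix j assume "j < dim_col (A * Y)"
    then have j: "j < n" using Y by simp
    then show "col X j = col (A * Y) j"
      using col_mult2[OF A Y j] colY y by simp
  qed (use A X Y in auto)
  with Y show "\<exists>Y \<in> carrier_mat n n. X = A * Y" by blast
next
  assume "\<exists>Y \<in> carrier_mat n n. X = A * Y"
  then obtain Y where Y: "Y \<in> carrier_mat n n" and XY: "X = A * Y" by blast
  have "X *\<^sub>v x = A *\<^sub>v (Y *\<^sub>v x)" "Y *\<^sub>v x \<in> carrier_vec n" if "x \<in> carrier_vec n" for x
    using that A Y by (auto simp: XY)
  then show "mat_range n X \<subseteq> mat_range n A"
    using A X by (fastforce simp: mat_range_eq)
qed

section \<open>Orthogonal projections and the normal equations\<close>

text \<open>Values of \<open>A * X\<close> lie in the range of \<open>A\<close>, so what remains is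
  that each residual of \<open>x\<close> is orthogonal to that range. By adjointness this says that
  \<open>mat_adjoint A\<close> kills every residual.\<close>

lemma orthogonal_projection_mult_iff:
  assumes A: "A \<in> carrier_mat n n" and X: "X \<in> carrier_mat n n"
  shows "is_orthogonal_projection n (mat_range n A) (A * X) \<longleftrightarrow>
    mat_adjoint A * (A * X) = mat_adjoint A"
proof -
  let ?P = "A * X"
  have P: "?P \<in> carrier_mat n n" and A': "mat_adjoint A \<in> carrier_mat n n" using A X by auto
  have residual: "mat_adjoint A *\<^sub>v (x - ?P *\<^sub>v x) =
      mat_adjoint A *\<^sub>v x - (mat_adjoint A * ?P) *\<^sub>v x"
    if x: "x \<in> carrier_vec n" for x
  proof -
    have "?P *\<^sub>v x \<in> carrier_vec n" using P x by auto
    then show ?thesis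
      using mult_minus_distrib_mat_vec[OF A' x] assoc_mult_mat_vec[OF A' P x] by simp
  qed
  show ?thesis
  proof
    assume proj: "is_orthogonal_projection n (mat_range n A) ?P"
    show "mat_adjoint A * ?P = mat_adjoint A"
    proof (rule eq_mat_mult_vecI)
      fix x :: "complex vec" assume x: "x \<in> carrier_vec n"
      let ?r = "x - ?P *\<^sub>v x"
      have Px: "?P *\<^sub>v x \<in> carrier_vec n" using P x by auto
      have r: "?r \<in> carrier_vec n" using Px x by auto
      have A'r: "mat_adjoint A *\<^sub>v ?r \<in> carrier_vec n" using A' r by auto
      \<comment> \<open>Testing \<open>?r\<close> against this vector of the range makes the inner
        product the squared norm of \<open>mat_adjoint A\<close> applied to
        \<open>?r\<close>.\<close>
      have "?r \<bullet>c (A *\<^sub>v (mat_adjoint A *\<^sub>v ?r)) = 0"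
        using proj x A A'r unfolding is_orthogonal_projection_def by (auto simp: mat_range_eq)
      then have "mat_adjoint A *\<^sub>v ?r = 0\<^sub>v n"
        using cscalar_prod_mult_mat_vec[OF A r A'r] A'r conjugate_square_eq_0_vec by metis
      then have diff: "mat_adjoint A *\<^sub>v x - (mat_adjoint A * ?P) *\<^sub>v x = 0\<^sub>v n"
        using residual[OF x] by simp
      have c: "mat_adjoint A *\<^sub>v x \<in> carrier_vec n" "(mat_adjoint A * ?P) *\<^sub>v x \<in> carrier_vec n"
        using A' P x by (meson mult_carrier_mat mult_mat_vec_carrier)+
      show "(mat_adjoint A * ?P) *\<^sub>v x = mat_adjoint A *\<^sub>v x"
      proof (rule eq_vecI)
        fix i assume "i < dim_vec (mat_adjoint A *\<^sub>v x)"
        then have i: "i < n" using c by (metis carrier_vecD)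
        then have "(mat_adjoint A *\<^sub>v x - (mat_adjoint A * ?P) *\<^sub>v x) $ i = 0" by (simp add: diff)
        moreover have "(mat_adjoint A *\<^sub>v x - (mat_adjoint A * ?P) *\<^sub>v x) $ i =
            (mat_adjoint A *\<^sub>v x) $ i - ((mat_adjoint A * ?P) *\<^sub>v x) $ i"
          using i carrier_vecD[OF c(2)] by (intro index_minus_vec(1)) simp
        ultimately show "((mat_adjoint A * ?P) *\<^sub>v x) $ i = (mat_adjoint A *\<^sub>v x) $ i" by simp
      qed (use c in \<open>metis carrier_vecD\<close>)
    qed (use A' P in auto)
  next
    assume normal: "mat_adjoint A * ?P = mat_adjoint A"
    show "is_orthogonal_projection n (mat_range n A) ?P"
      unfolding is_orthogonal_projection_def
    proof (intro conjI ballI)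
      fix x :: "complex vec" assume x: "x \<in> carrier_vec n"
      have Xx: "X *\<^sub>v x \<in> carrier_vec n" using X x by auto
      then show "?P *\<^sub>v x \<in> mat_range n A"
        using assoc_mult_mat_vec[OF A X x] A by (auto simp: mat_range_eq)
      fix y assume "y \<in> mat_range n A"
      then obtain z where z: "z \<in> carrier_vec n" and y: "y = A *\<^sub>v z"
        using A by (auto simp: mat_range_eq)
      have "?P *\<^sub>v x \<in> carrier_vec n" using P x by auto
      then have r: "x - ?P *\<^sub>v x \<in> carrier_vec n" using x by auto
      have "mat_adjoint A *\<^sub>v x \<in> carrier_vec n" using A' x by auto
      then have "mat_adjoint A *\<^sub>v (x - ?P *\<^sub>v x) = 0\<^sub>v n"
        using residual[OF x] by (simp add: normal)
      then show "(x - ?P *\<^sub>v x) \<bullet>c y = 0"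
        using cscalar_prod_mult_mat_vec[OF A r z] z by (simp add: y)
    qed (rule P)
  qed
qed

section \<open>Inner inverses whose range lies in that of \<open>A\<close>\<close>

text \<open>
  With the idempotent \<open>E = A X\<close>, the matrix \<open>X + 1 - E\<close> is a right inverse of \<open>A E + 1 - E\<close>,
  hence also a left inverse; applying the two to \<open>A\<close> in turn yields \<open>X A A\<close>.
\<close>
lemma inner_inverse_in_range_mult:
  fixes A :: "'a :: field mat"
  assumes A: "A \<in> carrier_mat n n" and Y: "Y \<in> carrier_mat n n"
    and XY: "X = A * Y" and AXA: "A * X * A = A"
  shows "X * A * A = A"
proof -
  have X: "X \<in> carrier_mat n n" using A Y XY by auto
  define E where "E = A * X"
  define F where "F = 1\<^sub>m n - E"
  \<comment> \<open>\<open>U\<close> acts as \<open>A\<close> on the range of \<open>E\<close>,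
    which is the range of \<open>A\<close>, and as the identity on the range of
    \<open>F\<close>.\<close>
  define U where "U = A * E + F"
  define W where "W = X + F"
  have E: "E \<in> carrier_mat n n" using A X by (simp add: E_def)
  have F: "F \<in> carrier_mat n n" unfolding F_def by (rule minus_carrier_mat[OF E])
  have U: "U \<in> carrier_mat n n" and W: "W \<in> carrier_mat n n"
    using A E F X by (auto simp: U_def W_def)
  note assoc = assoc_mult_mat[of _ n n _ n _ n]
  have EA: "E * A = A" using AXA by (simp add: E_def)
  \<comment> \<open>The factorization \<open>X = A * Y\<close> enters here: \<open>E\<close> fixes
    \<open>A\<close>, hence also every right multiple of \<open>A\<close>.\<close>
  have EX: "E * X = X" using assoc[OF E A Y] EA by (simp add: XY)
  have EE: "E * E = E" using assoc[OF E A X] EA by (simp add: E_def)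
  have EF: "E * F = 0\<^sub>m n n"
    unfolding F_def using E by (simp add: mult_minus_distrib_mat[OF E one_carrier_mat E] EE)
  have F_mult: "F * M = M - E * M" if "M \<in> carrier_mat n n" for M
    unfolding F_def using that E by (simp add: minus_mult_distrib_mat[OF one_carrier_mat E that])
  have FA: "F * A = 0\<^sub>m n n" using A by (simp add: F_mult EA)
  have EW: "E * W = X"
    using X F by (simp add: W_def mult_add_distrib_mat[OF E X F] EX EF)
  have FW: "F * W = F"
  proof -
    have "F * W = X + F - X" using W by (simp add: F_mult EW) (simp add: W_def)
    also have "\<dots> = F" using X F by (intro eq_matI) auto
    finally show ?thesis .
  qed
  have "U * W = A * E * W + F * W"
    unfolding U_def using A E F W by (intro add_mult_distrib_mat) auto
  also have "\<dots> = E + F" using assoc[OF A E W] by (simp add: EW FW) (simp add: E_def)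
  also have "\<dots> = 1\<^sub>m n" using E by (intro eq_matI) (auto simp: F_def)
  \<comment> \<open>Finite dimension enters here: in a general ring a right inverse need not be a
    left inverse.\<close>
  finally have WU: "W * U = 1\<^sub>m n" by (rule mat_mult_left_right_inverse[OF U W])
  have "U * A = A * E * A + F * A"
    unfolding U_def using A E F by (intro add_mult_distrib_mat) auto
  then have UA: "U * A = A * A" using A assoc[OF A E A] by (simp add: EA FA)
  have WA: "W * A = X * A"
    using A X by (simp add: W_def add_mult_distrib_mat[OF X F A] FA)
  have "A = W * (U * A)" using assoc[OF W U A] A by (simp add: WU)
  also have "\<dots> = X * A * A" using assoc[OF W A A] by (simp add: UA WA)
  finally show ?thesis by simp
qed

section \<open>The core inverse through matrix identities\<close>

lemma is_core_inverse_iff: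
  assumes A: "A \<in> carrier_mat n n" and X: "X \<in> carrier_mat n n"
  shows "is_core_inverse n A X \<longleftrightarrow>
    mat_adjoint A * (A * X) = mat_adjoint A \<and> (\<exists>Y \<in> carrier_mat n n. X = A * Y)"
  using X by (simp add: is_core_inverse_def orthogonal_projection_mult_iff[OF A X]
      mat_range_subset_iff[OF A X])

text \<open>Multiplying the normal equation on the left by \<open>mat_adjoint X\<close> gives
  \<open>mat_adjoint ?P = mat_adjoint ?P * ?P\<close>, whose right side is Hermitian; so
  \<open>?P\<close> is Hermitian. Once it is, the normal equation and \<open>?P * A = A\<close> are
  adjoints of each other.\<close>

lemma hermitian_inner_inverse_iff:
  assumes A: "A \<in> carrier_mat n n" and X: "X \<in> carrier_mat n n"
  shows "mat_adjoint A * (A * X) = mat_adjoint A \<longleftrightarrow>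
    A * X * A = A \<and> mat_adjoint (A * X) = A * X"
proof -
  let ?P = "A * X"
  have P: "?P \<in> carrier_mat n n" and P': "mat_adjoint ?P \<in> carrier_mat n n"
    and A': "mat_adjoint A \<in> carrier_mat n n" and X': "mat_adjoint X \<in> carrier_mat n n"
    using A X by auto
  show ?thesis
  proof (intro iffI conjI)
    assume normal: "mat_adjoint A * ?P = mat_adjoint A"
    have "mat_adjoint ?P = mat_adjoint X * (mat_adjoint A * ?P)"
      by (simp add: normal mat_adjoint_mult[OF A X])
    also have "\<dots> = mat_adjoint ?P * ?P"
      using assoc_mult_mat[OF X' A' P] by (simp add: mat_adjoint_mult[OF A X])
    finally have gram: "mat_adjoint ?P = mat_adjoint ?P * ?P" .
    then show herm: "mat_adjoint ?P = ?P"
      using mat_adjoint_mult[OF P' P] by (metis mat_adjoint_adjoint)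
    have "A = mat_adjoint (mat_adjoint A * ?P)" by (simp add: normal mat_adjoint_adjoint)
    also have "\<dots> = ?P * A" using mat_adjoint_mult[OF A' P] by (simp add: herm mat_adjoint_adjoint)
    finally show "?P * A = A" by simp
  next
    assume "?P * A = A \<and> mat_adjoint ?P = ?P"
    then show "mat_adjoint A * ?P = mat_adjoint A"
      using mat_adjoint_mult[OF P A] by simp
  qed
qed

section \<open>Principal one-sided ideals and factorizations\<close>

text \<open>The identity matrix puts \<open>A\<close> into its own right ideal, hence into that of
  \<open>B\<close>.\<close>

lemma right_ideal_eqD:
  fixes A B :: "'a :: semiring_1 mat"
  assumes "A \<in> carrier_mat n n"
    and "{A * Z |Z. Z \<in> carrier_mat n n} = {B * Z |Z. Z \<in> carrier_mat n n}"
  shows "\<exists>Z \<in> carrier_mat n n. A = B * Z"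
proof -
  have "A * 1\<^sub>m n \<in> {A * Z |Z. Z \<in> carrier_mat n n}" using one_carrier_mat by fast
  then show ?thesis
    unfolding assms(2) right_mult_one_mat[OF assms(1)] by blast
qed

lemma left_ideal_eqD:
  fixes A B :: "'a :: semiring_1 mat"
  assumes "A \<in> carrier_mat n n"
    and "{Z * A |Z. Z \<in> carrier_mat n n} = {Z * B |Z. Z \<in> carrier_mat n n}"
  shows "\<exists>Z \<in> carrier_mat n n. A = Z * B"
proof -
  have "1\<^sub>m n * A \<in> {Z * A |Z. Z \<in> carrier_mat n n}" using one_carrier_mat by fast
  then show ?thesis
    unfolding assms(2) left_mult_one_mat[OF assms(1)] by blast
qed

lemma right_ideal_subsetI:
  fixes A B :: "'a :: semiring_1 mat"
  assumes B: "B \<in> carrier_mat n n" and C: "C \<in> carrier_mat n n" and "A = B * C"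
  shows "{A * Z |Z. Z \<in> carrier_mat n n} \<subseteq> {B * Z |Z. Z \<in> carrier_mat n n}"
  using assoc_mult_mat[OF B C] mult_carrier_mat[OF C] assms(3) by blast

lemma left_ideal_subsetI:
  fixes A B :: "'a :: semiring_1 mat"
  assumes B: "B \<in> carrier_mat n n" and C: "C \<in> carrier_mat n n" and "A = C * B"
  shows "{Z * A |Z. Z \<in> carrier_mat n n} \<subseteq> {Z * B |Z. Z \<in> carrier_mat n n}"
  using assoc_mult_mat[OF _ C B, symmetric] mult_carrier_mat[OF _ C] assms(3) by blast

section \<open>The characterization by one-sided ideals\<close>

theorem lemma2p1:
  fixes n :: nat and A X :: "complex mat"
  assumes "A \<in> carrier_mat n n" and "X \<in> carrier_mat n n"
  shows "is_core_inverse n A X \<longleftrightarrow>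
    A * X * A = A \<and>
    {X * Z |Z. Z \<in> carrier_mat n n} = {A * Z |Z. Z \<in> carrier_mat n n} \<and>
    {Z * X |Z. Z \<in> carrier_mat n n} = {Z * mat_adjoint A |Z. Z \<in> carrier_mat n n}"
proof -
  note A = assms(1) and X = assms(2)
  let ?P = "A * X"
  have P: "?P \<in> carrier_mat n n" and A': "mat_adjoint A \<in> carrier_mat n n"
    and X': "mat_adjoint X \<in> carrier_mat n n"
    using A X by auto
  note assoc = assoc_mult_mat[of _ n n _ n _ n]
  \<comment> \<open>Both directions use this: writing the last factor \<open>X\<close> as
    \<open>A * Y\<close> exposes \<open>X * A * A\<close>, which collapses to
    \<open>A\<close>.\<close>
  have X_outer: "X * ?P = X" if Y: "Y \<in> carrier_mat n n" and XY: "X = A * Y"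
    and AXA: "?P * A = A" for Y
  proof -
    have XA: "X * A \<in> carrier_mat n n" using A X by simp
    have "X * ?P = X * A * A * Y"
      using assoc[OF X A X] assoc[OF XA A Y] by (simp add: XY)
    then show ?thesis using inner_inverse_in_range_mult[OF A Y XY AXA] XY by simp
  qed
  show ?thesis
  proof
    assume "is_core_inverse n A X"
    then obtain Y where Y: "Y \<in> carrier_mat n n" and XY: "X = A * Y"
      and normal: "mat_adjoint A * ?P = mat_adjoint A"
      unfolding is_core_inverse_iff[OF A X] by blast
    have AXA: "?P * A = A" and herm: "mat_adjoint ?P = ?P"
      using normal unfolding hermitian_inner_inverse_iff[OF A X] by blast+
    \<comment> \<open>This factors \<open>A\<close> through \<open>X\<close> on the left; together
      with \<open>X = A * Y\<close> it gives both inclusions of right ideals.\<close>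
    have "A = X * (A * A)"
      using inner_inverse_in_range_mult[OF A Y XY AXA] assoc[OF X A A] by simp
    then have right: "{X * Z |Z. Z \<in> carrier_mat n n} = {A * Z |Z. Z \<in> carrier_mat n n}"
      using right_ideal_subsetI[OF A Y XY] right_ideal_subsetI[OF X, of "A * A" A] A by simp
    \<comment> \<open>In \<open>X = X * ?P\<close> the Hermitian factor \<open>?P\<close> is
      replaced by its adjoint, which ends in \<open>mat_adjoint A\<close>.\<close>
    have "X = X * mat_adjoint X * mat_adjoint A"
      using X_outer[OF Y XY AXA] herm mat_adjoint_mult[OF A X] assoc[OF X X' A'] by simp
    \<comment> \<open>The normal equation, rebracketed, supplies the opposite inclusion of left
      ideals.\<close>
    moreover have "mat_adjoint A = mat_adjoint A * A * X"
      using normal assoc[OF A' A X] by simp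
    ultimately have "{Z * X |Z. Z \<in> carrier_mat n n} = {Z * mat_adjoint A |Z. Z \<in> carrier_mat n n}"
      using left_ideal_subsetI[OF A', of "X * mat_adjoint X" X]
        left_ideal_subsetI[OF X, of "mat_adjoint A * A" "mat_adjoint A"] A X A' X'
      by (intro subset_antisym) auto
    with AXA right show "?P * A = A \<and>
        {X * Z |Z. Z \<in> carrier_mat n n} = {A * Z |Z. Z \<in> carrier_mat n n} \<and>
        {Z * X |Z. Z \<in> carrier_mat n n} = {Z * mat_adjoint A |Z. Z \<in> carrier_mat n n}"
      by blast
  next
    assume "?P * A = A \<and>
        {X * Z |Z. Z \<in> carrier_mat n n} = {A * Z |Z. Z \<in> carrier_mat n n} \<and>
        {Z * X |Z. Z \<in> carrier_mat n n} = {Z * mat_adjoint A |Z. Z \<in> carrier_mat n n}"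
    then have AXA: "?P * A = A"
      and right: "{X * Z |Z. Z \<in> carrier_mat n n} = {A * Z |Z. Z \<in> carrier_mat n n}"
      and left: "{Z * X |Z. Z \<in> carrier_mat n n} = {Z * mat_adjoint A |Z. Z \<in> carrier_mat n n}"
      by blast+
    obtain Y where Y: "Y \<in> carrier_mat n n" and XY: "X = A * Y"
      using right_ideal_eqD[OF X right] by blast
    obtain Z where Z: "Z \<in> carrier_mat n n" and A'Z: "mat_adjoint A = Z * X"
      using left_ideal_eqD[OF A' left[symmetric]] by blast
    \<comment> \<open>With \<open>mat_adjoint A = Z * X\<close>, the normal equation is
      \<open>X * ?P = X\<close> multiplied on the left by \<open>Z\<close>.\<close>
    have "mat_adjoint A * ?P = mat_adjoint A"
      using assoc[OF Z X P] X_outer[OF Y XY AXA] by (simp add: A'Z)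
    then show "is_core_inverse n A X"
      using Y XY unfolding is_core_inverse_iff[OF A X] by blast
  qed
qed

end
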